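(* Let $\Gamma$ and $\Sigma$ be finite simple graphs such that the pair $(\Gamma,\Sigma)$ is stable. Then $\Gamma$ and $\Sigma$ are coprime $R$-thin graphs. Moreover, if in addition both $\mathrm{Aut}(\Gamma)$ and $\mathrm{Aut}(\Sigma)$ are nontrivial groups, then both $\Gamma$ and $\Sigma$ are connected and at least one of them is non-bipartite.
   Context: The direct product $\Gamma\times\Sigma$ has vertex set $V(\Gamma)\times V(\Sigma)$, with $(u,x)$ adjacent to $(v,y)$ iff $u\sim v$ in $\Gamma$ and $x\sim y$ in $\Sigma$. A pair of graphs $(\Gamma,\Sigma)$ is stable if $\mathrm{Aut}(\Gamma\times\Sigma)\cong\mathrm{Aut}(\Gamma)\times\mathrm{Aut}(\Sigma)$ (as abstract groups), and unstable otherwise. A graph is $R$-thick if it has two distinct vertices with the same neighbourhood, and $R$-thin otherwise. A graph is prime (with respect to the direct product) if it has more than one vertex and is not isomorphic to a direct product of two graphs with fewer vertices. Two graphs are coprime if they have no common direct-product factor with more than one vertex, i.e. there is no graph $\Delta$ with $|V(\Delta)|>1$ and graphs $\Gamma_1,\Sigma_1$ with $\Gamma\cong\Gamma_1\times\Delta$ and $\Sigma\cong\Sigma_1\times\Delta$.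
   Formalization: Graphs are taken non-null, and pairs consisting of a one-vertex graph and an edgeless graph on at least two vertices are excluded, since such pairs are stable although the edgeless graph is R-thick. *)

theory Defs
  imports
    "Graph_Theory.Graph_Theory"
    "HOL-Algebra.Bij"
    "HOL-Algebra.Elementary_Groups"
begin

text \<open>
  A finite simple graph is a \<^locale>\<open>pair_graph\<close>: finitely many vertices, a symmetric loop-free set
  of arcs. A \<^locale>\<open>pair_pseudo_graph\<close> is the same with loops allowed. Both locales admit the null
  graph, so non-emptiness of the vertex set has to be required separately.
\<close>

definition direct_product ::
  "'a pair_pre_digraph \<Rightarrow> 'b pair_pre_digraph \<Rightarrow> ('a \<times> 'b) pair_pre_digraph" where
  "direct_product G H =
    \<lparr> pverts = pverts G \<times> pverts H,
      parcs = {((u, x), (v, y)) |u x v y. (u, v) \<in> parcs G \<and> (x, y) \<in> parcs H} \<rparr>"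

text \<open>As in \<^const>\<open>BijGroup\<close>, automorphisms are extensional, i.e. determined by their values on the
  vertex set.\<close>

definition graph_auts :: "'a pair_pre_digraph \<Rightarrow> ('a \<Rightarrow> 'a) set" where
  "graph_auts G =
    {f \<in> Bij (pverts G). \<forall>u \<in> pverts G. \<forall>v \<in> pverts G. (f u, f v) \<in> parcs G \<longleftrightarrow> (u, v) \<in> parcs G}"

definition graph_Aut :: "'a pair_pre_digraph \<Rightarrow> ('a \<Rightarrow> 'a) monoid" where
  "graph_Aut G = BijGroup (pverts G) \<lparr>carrier := graph_auts G\<rparr>"

definition stable_pair :: "'a pair_pre_digraph \<Rightarrow> 'b pair_pre_digraph \<Rightarrow> bool" where
  "stable_pair G H \<longleftrightarrow> graph_Aut (direct_product G H) \<cong> graph_Aut G \<times>\<times> graph_Aut H"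

definition neighbourhood :: "'a pair_pre_digraph \<Rightarrow> 'a \<Rightarrow> 'a set" where
  "neighbourhood G v = {w. (v, w) \<in> parcs G}"

definition R_thick :: "'a pair_pre_digraph \<Rightarrow> bool" where
  "R_thick G \<longleftrightarrow>
    (\<exists>u \<in> pverts G. \<exists>v \<in> pverts G. u \<noteq> v \<and> neighbourhood G u = neighbourhood G v)"

abbreviation R_thin :: "'a pair_pre_digraph \<Rightarrow> bool" where
  "R_thin G \<equiv> \<not> R_thick G"

definition bipartite :: "'a pair_pre_digraph \<Rightarrow> bool" where
  "bipartite G \<longleftrightarrow>
    (\<exists>U W. U \<union> W = pverts G \<and> U \<inter> W = {} \<and>
      (\<forall>(u, v) \<in> parcs G. u \<in> U \<and> v \<in> W \<or> u \<in> W \<and> v \<in> U))"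

text \<open>
  Factors may have loops. The unit of the direct product is a single vertex with a loop, so
  without loops a graph would in general not be a factor of itself, and e.g. two copies of the
  triangle would count as coprime. Allowing loops makes coprimality the more demanding property:
  it implies that there is no common loop-free factor.

  The factors live on natural numbers, which is no restriction: see \<open>not_coprime_graphsI\<close>.
\<close>

definition coprime_graphs :: "'a pair_pre_digraph \<Rightarrow> 'b pair_pre_digraph \<Rightarrow> bool" where
  "coprime_graphs G H \<longleftrightarrow>
    \<not> (\<exists>(D :: nat pair_pre_digraph) (G1 :: nat pair_pre_digraph) (H1 :: nat pair_pre_digraph).
        pair_pseudo_graph D \<and> pair_pseudo_graph G1 \<and> pair_pseudo_graph H1 \<and>
        card (pverts D) > 1 \<and>
        digraph_iso (with_proj G) (with_proj (direct_product G1 D)) \<and>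
        digraph_iso (with_proj H) (with_proj (direct_product H1 D)))"


lemma Bij_apply: "f \<in> Bij S \<Longrightarrow> x \<in> S \<Longrightarrow> f x \<in> S"
  by (auto simp: Bij_def bij_betw_def)

lemma group_graph_Aut: "group (graph_Aut G)"
proof -
  let ?V = "pverts G"
  have "subgroup (graph_auts G) (BijGroup ?V)"
  proof (rule group.subgroupI[OF group_BijGroup])
    show "graph_auts G \<subseteq> carrier (BijGroup ?V)"
      by (auto simp: graph_auts_def BijGroup_def)
    have "(\<lambda>x\<in>?V. x) \<in> graph_auts G"
      by (auto simp: graph_auts_def id_Bij)
    then show "graph_auts G \<noteq> {}" by blast
  next
    fix f assume f: "f \<in> graph_auts G"
    then have B: "f \<in> Bij ?V" by (simp add: graph_auts_def)
    have inv: "inv_into ?V f x \<in> ?V" "f (inv_into ?V f x) = x" if "x \<in> ?V" for x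
      using B that by (auto simp: Bij_def bij_betw_def inv_into_into f_inv_into_f)
    have "(\<lambda>x \<in> ?V. inv_into ?V f x) \<in> graph_auts G"
      unfolding graph_auts_def
    proof (intro CollectI conjI ballI restrict_inv_into_Bij B)
      fix u v assume uv: "u \<in> ?V" "v \<in> ?V"
      have "(f (inv_into ?V f u), f (inv_into ?V f v)) \<in> parcs G
          \<longleftrightarrow> (inv_into ?V f u, inv_into ?V f v) \<in> parcs G"
        using f inv uv unfolding graph_auts_def by blast
      then show "((\<lambda>x \<in> ?V. inv_into ?V f x) u, (\<lambda>x \<in> ?V. inv_into ?V f x) v) \<in> parcs G
          \<longleftrightarrow> (u, v) \<in> parcs G"
        using uv inv by simp
    qed
    then show "inv\<^bsub>BijGroup ?V\<^esub> f \<in> graph_auts G"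
      using B by (simp add: inv_BijGroup)
  next
    fix f g assume fg: "f \<in> graph_auts G" "g \<in> graph_auts G"
    then have "compose ?V f g \<in> graph_auts G"
      by (auto simp: graph_auts_def compose_Bij compose_eq Bij_apply)
    then show "f \<otimes>\<^bsub>BijGroup ?V\<^esub> g \<in> graph_auts G"
      using fg by (simp add: BijGroup_def graph_auts_def)
  qed
  then show ?thesis
    unfolding graph_Aut_def by (rule subgroup.subgroup_is_group) (rule group_BijGroup)
qed

lemma wf_direct_product:
  assumes "pair_wf_digraph G" "pair_wf_digraph H"
  shows "pair_wf_digraph (direct_product G H)"
  using assms by (fastforce simp: pair_wf_digraph_def direct_product_def)

lemma digraph_iso_with_projI:
  assumes wf: "pair_wf_digraph G"
    and inj: "inj_on f (pverts G)"
    and V: "pverts H = f ` pverts G"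
    and A: "parcs H = map_prod f f ` parcs G"
  shows "digraph_iso (with_proj G) (with_proj H)"
proof -
  let ?h = "\<lparr> iso_verts = f, iso_arcs = map_prod f f, iso_head = snd, iso_tail = fst \<rparr>"
  have sub: "parcs G \<subseteq> pverts G \<times> pverts G"
    using wf by (auto simp: pair_wf_digraph_def)
  have "inj_on (map_prod f f) (parcs G)"
    by (rule inj_on_subset[OF map_prod_inj_on[OF inj inj] sub])
  then have "pre_digraph.digraph_isomorphism (with_proj G) ?h"
    using wf inj by (simp add: pre_digraph.digraph_isomorphism_def wf_digraph_wp_iff)
  moreover have "with_proj H = app_iso ?h (with_proj G)"
    by (simp add: app_iso_def V A with_proj_def)
  ultimately show ?thesis unfolding digraph_iso_def by blast
qed

lemma nat_copy:
  fixes G :: "'a pair_pre_digraph"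
  assumes "pair_pseudo_graph G"
  obtains G' :: "nat pair_pre_digraph" and f where
    "pair_pseudo_graph G'" "inj_on f (pverts G)" "pverts G' = f ` pverts G"
    "parcs G' = map_prod f f ` parcs G"
proof -
  interpret pair_pseudo_graph G by fact
  obtain f :: "'a \<Rightarrow> nat" where f: "inj_on f (pverts G)"
    using finite_imp_inj_to_nat_seg[OF pair_finite_verts] by blast
  let ?G = "\<lparr>pverts = f ` pverts G, parcs = map_prod f f ` parcs G\<rparr>"
  have "pair_pseudo_graph ?G"
  proof
    show "symmetric (with_proj ?G)"
      using pair_sym_arcs by (auto simp: symmetric_def sym_def)
  qed (auto dest: wellformed' simp: pair_finite_verts pair_finite_arcs)
  with f show ?thesis by (intro that[of ?G f]) auto
qed

lemma direct_product_map:
  assumes "pverts G' = f ` pverts G" "parcs G' = map_prod f f ` parcs G"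
    and "pverts H' = g ` pverts H" "parcs H' = map_prod g g ` parcs H"
  shows "pverts (direct_product G' H') = map_prod f g ` pverts (direct_product G H)"
    and "parcs (direct_product G' H') =
      map_prod (map_prod f g) (map_prod f g) ` parcs (direct_product G H)"
proof -
  show "pverts (direct_product G' H') = map_prod f g ` pverts (direct_product G H)"
    using assms by (simp add: direct_product_def map_prod_surj_on)
  show "parcs (direct_product G' H') =
      map_prod (map_prod f g) (map_prod f g) ` parcs (direct_product G H)" (is "?A = ?B")
  proof (intro equalityI subsetI)
    fix p assume p: "p \<in> ?A"
    obtain u x v y where eq: "p = ((u, x), v, y)" by (metis prod.collapse)
    obtain a b c d where "(a, b) \<in> parcs G" "(c, d) \<in> parcs H"
      "u = f a" "v = f b" "x = g c" "y = g d"
      using p assms(2,4) unfolding eq direct_product_def by auto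
    then show "p \<in> ?B"
      unfolding eq direct_product_def by (intro image_eqI[of _ _ "((a, c), b, d)"]) auto
  next
    fix p assume "p \<in> ?B"
    then show "p \<in> ?A"
      using assms(2,4) by (fastforce simp: direct_product_def)
  qed
qed

lemma digraph_iso_direct_product_nat:
  fixes f :: "'c \<Rightarrow> nat" and g :: "'d \<Rightarrow> nat"
  assumes "digraph_iso (with_proj G) (with_proj (direct_product G1 D))"
    and "pair_wf_digraph G1" "pair_wf_digraph D"
    and "inj_on f (pverts G1)" "pverts G1' = f ` pverts G1" "parcs G1' = map_prod f f ` parcs G1"
    and "inj_on g (pverts D)" "pverts D' = g ` pverts D" "parcs D' = map_prod g g ` parcs D"
  shows "digraph_iso (with_proj G) (with_proj (direct_product G1' D'))"
proof (rule digraph_iso_trans[OF assms(1)])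
  have "inj_on (map_prod f g) (pverts (direct_product G1 D))"
    using map_prod_inj_on[OF assms(4,7)] by (simp add: direct_product_def)
  then show "digraph_iso (with_proj (direct_product G1 D)) (with_proj (direct_product G1' D'))"
    using direct_product_map[OF assms(5,6,8,9)] wf_direct_product[OF assms(2,3)]
    by (intro digraph_iso_with_projI) auto
qed

lemma not_coprime_graphsI:
  fixes D :: "'d pair_pre_digraph" and G1 :: "'c pair_pre_digraph" and H1 :: "'e pair_pre_digraph"
  assumes ps: "pair_pseudo_graph D" "pair_pseudo_graph G1" "pair_pseudo_graph H1"
    and card: "card (pverts D) > 1"
    and isoG: "digraph_iso (with_proj G) (with_proj (direct_product G1 D))"
    and isoH: "digraph_iso (with_proj H) (with_proj (direct_product H1 D))"
  shows "\<not> coprime_graphs G H"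
proof -
  note wf = ps[THEN pair_pseudo_graph.axioms(1), THEN pair_fin_digraph.axioms(1)]
  obtain D' :: "nat pair_pre_digraph" and d where D': "pair_pseudo_graph D'" "inj_on d (pverts D)"
    "pverts D' = d ` pverts D" "parcs D' = map_prod d d ` parcs D"
    using nat_copy[OF ps(1)] by metis
  obtain G1' :: "nat pair_pre_digraph" and f where G1': "pair_pseudo_graph G1'" "inj_on f (pverts G1)"
    "pverts G1' = f ` pverts G1" "parcs G1' = map_prod f f ` parcs G1"
    using nat_copy[OF ps(2)] by metis
  obtain H1' :: "nat pair_pre_digraph" and g where H1': "pair_pseudo_graph H1'" "inj_on g (pverts H1)"
    "pverts H1' = g ` pverts H1" "parcs H1' = map_prod g g ` parcs H1"
    using nat_copy[OF ps(3)] by metis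
  have "card (pverts D') > 1"
    using card D'(2,3) by (simp add: card_image)
  moreover have "digraph_iso (with_proj G) (with_proj (direct_product G1' D'))"
    by (rule digraph_iso_direct_product_nat[OF isoG wf(2,1) G1'(2-4) D'(2-4)])
  moreover have "digraph_iso (with_proj H) (with_proj (direct_product H1' D'))"
    by (rule digraph_iso_direct_product_nat[OF isoH wf(3,1) H1'(2-4) D'(2-4)])
  ultimately show ?thesis
    unfolding coprime_graphs_def using D'(1) G1'(1) H1'(1) by blast
qed

text \<open>
  A degenerate case: a one-vertex graph and an edgeless graph always form a stable pair, although
  an edgeless graph with at least two vertices is R-thick, all of its neighbourhoods being empty.
  Stability therefore yields R-thinness only when this case is excluded.
\<close>

lemma stable_pair_degenerate:
  assumes "pverts G = {a}" "parcs G = {}" "parcs H = {}"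
  shows "stable_pair G H"
proof -
  let ?W = "pverts H"
  let ?V = "{a} \<times> ?W"
  let ?P = "direct_product G H"
  have autG: "graph_auts G = {\<lambda>x\<in>{a}. x}"
  proof -
    have "f = (\<lambda>x\<in>{a}. x)" if "f \<in> Bij {a}" for f
    proof (rule extensionalityI)
      show "f \<in> extensional {a}" using that by (simp add: Bij_def)
      show "f x = (\<lambda>x\<in>{a}. x) x" if "x \<in> {a}" for x
        using Bij_apply[OF \<open>f \<in> Bij {a}\<close> that] that by simp
    qed simp
    then have "Bij {a} = {\<lambda>x\<in>{a}. x}" using id_Bij[of "{a}"] by blast
    moreover have "graph_auts G = Bij {a}" by (simp add: graph_auts_def assms)
    ultimately show ?thesis by simp
  qed
  have autH: "graph_auts H = Bij ?W" using assms by (auto simp: graph_auts_def)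
  have P: "pverts ?P = ?V" "parcs ?P = {}" using assms by (auto simp: direct_product_def)
  then have autP: "graph_auts ?P = Bij ?V" by (auto simp: graph_auts_def)
  let ?h = "\<lambda>(f :: 'a \<Rightarrow> 'a, g). \<lambda>p \<in> ?V. (a, g (snd p))"
  have hB: "?h (f, g) \<in> Bij ?V" if g: "g \<in> Bij ?W" for f g
  proof -
    have "inj_on g ?W" "g ` ?W = ?W" using g by (auto simp: Bij_def bij_betw_def)
    moreover from this have "?h (f, g) ` ?V = ?V" by force
    moreover have "inj_on (?h (f, g)) ?V"
      using \<open>inj_on g ?W\<close> by (auto simp: inj_on_def)
    ultimately show ?thesis by (simp add: Bij_def bij_betw_def)
  qed
  have "?h \<in> iso (graph_Aut G \<times>\<times> graph_Aut H) (graph_Aut ?P)"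
  proof (rule isoI)
    show "?h \<in> hom (graph_Aut G \<times>\<times> graph_Aut H) (graph_Aut ?P)"
    proof (rule homI)
      fix x assume "x \<in> carrier (graph_Aut G \<times>\<times> graph_Aut H)"
      then show "?h x \<in> carrier (graph_Aut ?P)"
        using hB by (auto simp: graph_Aut_def DirProd_def autG autH autP)
    next
      fix x y assume "x \<in> carrier (graph_Aut G \<times>\<times> graph_Aut H)"
        "y \<in> carrier (graph_Aut G \<times>\<times> graph_Aut H)"
      then obtain f f' g g' where xy: "x = (f, g)" "y = (f', g')" "g \<in> Bij ?W" "g' \<in> Bij ?W"
        by (auto simp: graph_Aut_def DirProd_def autG autH)
      have "?h (k, compose ?W g g') = compose ?V (?h (f, g)) (?h (f', g'))" for k
        using xy by (auto simp: compose_def restrict_def fun_eq_iff Bij_apply)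
      then show "?h (x \<otimes>\<^bsub>graph_Aut G \<times>\<times> graph_Aut H\<^esub> y) = ?h x \<otimes>\<^bsub>graph_Aut ?P\<^esub> ?h y"
        using xy hB[of g f] hB[of g' f']
        by (simp add: graph_Aut_def DirProd_def BijGroup_def P)
    qed
    have "inj_on ?h ({\<lambda>x\<in>{a}. x} \<times> Bij ?W)"
    proof (rule inj_onI)
      fix x y assume x: "x \<in> {\<lambda>x\<in>{a}. x} \<times> Bij ?W" and y: "y \<in> {\<lambda>x\<in>{a}. x} \<times> Bij ?W"
        and eq: "?h x = ?h y"
      have "snd x w = snd y w" if "w \<in> ?W" for w
        using fun_cong[OF eq, of "(a, w)"] that by (auto simp: split_beta)
      then have "snd x = snd y"
        using x y by (intro extensionalityI[of _ ?W]) (auto simp: Bij_def)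
      then show "x = y" using x y by (auto simp: prod_eq_iff)
    qed
    moreover have "?h ` ({\<lambda>x\<in>{a}. x} \<times> Bij ?W) = Bij ?V"
    proof
      show "?h ` ({\<lambda>x\<in>{a}. x} \<times> Bij ?W) \<subseteq> Bij ?V" using hB by auto
      show "Bij ?V \<subseteq> ?h ` ({\<lambda>x\<in>{a}. x} \<times> Bij ?W)"
      proof
        fix k assume k: "k \<in> Bij ?V"
        then have kin: "inj_on k ?V" "k ` ?V = ?V" "k \<in> extensional ?V"
          by (auto simp: Bij_def bij_betw_def)
        define g where "g = (\<lambda>w \<in> ?W. snd (k (a, w)))"
        have kg: "k (a, w) = (a, g w)" "g w \<in> ?W" if "w \<in> ?W" for w
        proof -
          have "k (a, w) \<in> ?V" using that kin(2) by blast
          then show "k (a, w) = (a, g w)" "g w \<in> ?W" using that by (auto simp: g_def)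
        qed
        have "inj_on g ?W"
          using kin(1) kg(1) by (intro inj_onI) (metis (mono_tags) SigmaI inj_onD insertI1 snd_conv)
        moreover have "?W \<subseteq> g ` ?W"
        proof
          fix w assume "w \<in> ?W"
          then have "(a, w) \<in> k ` ?V" using kin(2) by simp
          then show "w \<in> g ` ?W" using kg by auto
        qed
        ultimately have "g \<in> Bij ?W"
          using kg(2) by (auto simp: Bij_def bij_betw_def g_def)
        moreover have "k = ?h (\<lambda>x\<in>{a}. x, g)"
          using kin(3) kg(1) by (intro extensionalityI[of _ ?V]) auto
        ultimately show "k \<in> ?h ` ({\<lambda>x\<in>{a}. x} \<times> Bij ?W)" by blast
      qed
    qed
    ultimately show "bij_betw ?h (carrier (graph_Aut G \<times>\<times> graph_Aut H)) (carrier (graph_Aut ?P))"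
      by (simp add: bij_betw_def graph_Aut_def DirProd_def autG autH autP)
  qed
  then show ?thesis
    unfolding stable_pair_def
    by (meson DirProd_group group.iso_sym group_graph_Aut is_isoI)
qed

lemma R_thick_edgeless:
  assumes "parcs H = {}" "card (pverts H) \<ge> 2"
  shows "R_thick H"
proof -
  have "finite (pverts H)" using assms(2) by (metis card.infinite not_numeral_le_zero)
  then obtain u v where "u \<in> pverts H" "v \<in> pverts H" "u \<noteq> v"
    using assms(2) card_le_Suc0_iff_eq[of "pverts H"] by fastforce
  then show ?thesis using assms(1) by (auto simp: R_thick_def neighbourhood_def)
qed

end

theory Submission
  imports Defs "HOL-Combinatorics.Transposition"
begin

text \<open>
  Pairs of automorphisms of the factors act faithfully on the product. Since all groups involved
  are finite, stability therefore forces every automorphism of the product to be such a pair. Each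
  claim then follows by exhibiting an automorphism of the product that is not of this form: the
  exchange of two twins in a single fibre, the exchange of a common factor between the two sides,
  or a pair of automorphisms applied on a union of components of the product only.
\<close>

section \<open>Product automorphisms that come from the factors\<close>

text \<open>Here \<open>\<theta>\<close> ranges over arbitrary functions, constrained only on the
  vertices of the product, so transpositions and compositions can be supplied without first making
  them extensional.\<close>

definition product_auts_only :: "'a pair_pre_digraph \<Rightarrow> 'b pair_pre_digraph \<Rightarrow> bool" where
  "product_auts_only G H \<longleftrightarrow>
    (\<forall>\<theta>. bij_betw \<theta> (pverts G \<times> pverts H) (pverts G \<times> pverts H) \<and>
      (\<forall>p \<in> pverts G \<times> pverts H. \<forall>q \<in> pverts G \<times> pverts H.
        (\<theta> p, \<theta> q) \<in> parcs (direct_product G H) \<longleftrightarrow> (p, q) \<in> parcs (direct_product G H)) \<longrightarrow>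
      (\<exists>f \<in> graph_auts G. \<exists>g \<in> graph_auts H. \<forall>u \<in> pverts G. \<forall>x \<in> pverts H. \<theta> (u, x) = (f u, g x)))"

lemma product_auts_onlyE:
  assumes "product_auts_only G H"
    and "bij_betw \<theta> (pverts G \<times> pverts H) (pverts G \<times> pverts H)"
    and "\<And>p q. p \<in> pverts G \<times> pverts H \<Longrightarrow> q \<in> pverts G \<times> pverts H \<Longrightarrow>
      (\<theta> p, \<theta> q) \<in> parcs (direct_product G H) \<longleftrightarrow> (p, q) \<in> parcs (direct_product G H)"
  obtains f g where "f \<in> graph_auts G" "g \<in> graph_auts H"
    "\<And>u x. u \<in> pverts G \<Longrightarrow> x \<in> pverts H \<Longrightarrow> \<theta> (u, x) = (f u, g x)"
  using assms(1)[unfolded product_auts_only_def, rule_format, of \<theta>] assms(2,3) that by blast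

lemma pverts_direct_product: "pverts (direct_product G H) = pverts G \<times> pverts H"
  by (simp add: direct_product_def)

lemma parcs_direct_product:
  "(p, q) \<in> parcs (direct_product G H) \<longleftrightarrow>
    (fst p, fst q) \<in> parcs G \<and> (snd p, snd q) \<in> parcs H"
  by (cases p; cases q) (auto simp: direct_product_def)

lemma graph_auts_bij: "f \<in> graph_auts G \<Longrightarrow> bij_betw f (pverts G) (pverts G)"
  by (simp add: graph_auts_def Bij_def)

lemma graph_auts_in: "f \<in> graph_auts G \<Longrightarrow> u \<in> pverts G \<Longrightarrow> f u \<in> pverts G"
  by (simp add: graph_auts_def Bij_apply)

lemma graph_auts_arc:
  "f \<in> graph_auts G \<Longrightarrow> u \<in> pverts G \<Longrightarrow> v \<in> pverts G \<Longrightarrow>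
    (f u, f v) \<in> parcs G \<longleftrightarrow> (u, v) \<in> parcs G"
  by (simp add: graph_auts_def)

lemma graph_auts_extensional: "f \<in> graph_auts G \<Longrightarrow> f \<in> extensional (pverts G)"
  by (simp add: graph_auts_def Bij_def)

lemma restrict_in_graph_auts:
  assumes "bij_betw \<theta> (pverts G) (pverts G)"
    and "\<And>u v. u \<in> pverts G \<Longrightarrow> v \<in> pverts G \<Longrightarrow> (\<theta> u, \<theta> v) \<in> parcs G \<longleftrightarrow> (u, v) \<in> parcs G"
  shows "restrict \<theta> (pverts G) \<in> graph_auts G"
  using assms by (auto simp: graph_auts_def Bij_def bij_betw_restrict_eq)

lemma id_in_graph_auts: "(\<lambda>u\<in>pverts G. u) \<in> graph_auts G"
  by (rule restrict_in_graph_auts) (auto simp: bij_betw_def)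

lemma finite_graph_auts: "finite (pverts G) \<Longrightarrow> finite (graph_auts G)"
proof (rule finite_subset)
  show "graph_auts G \<subseteq> pverts G \<rightarrow>\<^sub>E pverts G"
    by (auto simp: graph_auts_in extensional_arb[OF graph_auts_extensional])
qed (auto intro: finite_PiE)

lemma nontrivial_graph_AutE:
  assumes "\<not> trivial_group (graph_Aut G)"
  obtains f u where "f \<in> graph_auts G" "u \<in> pverts G" "f u \<noteq> u"
proof -
  have "\<not> graph_auts G \<subseteq> {\<lambda>u\<in>pverts G. u}"
    using assms group.trivial_group_subset[OF group_graph_Aut, of G]
    by (simp add: graph_Aut_def BijGroup_def)
  then obtain f where f: "f \<in> graph_auts G" "f \<noteq> (\<lambda>u\<in>pverts G. u)" by blast
  have "\<exists>u \<in> pverts G. f u \<noteq> u"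
    using f extensionalityI[OF graph_auts_extensional[OF f(1)] restrict_extensional, of "\<lambda>u. u"]
    by auto
  then show ?thesis using f that by blast
qed

lemma bij_betw_map_prod_Times:
  assumes "bij_betw f A A'" "bij_betw g B B'"
  shows "bij_betw (map_prod f g) (A \<times> B) (A' \<times> B')"
  using assms by (auto simp: bij_betw_def map_prod_inj_on map_prod_surj_on)

lemma map_prod_graph_auts_arc:
  assumes "f \<in> graph_auts G" "g \<in> graph_auts H"
    and "p \<in> pverts G \<times> pverts H" "q \<in> pverts G \<times> pverts H"
  shows "(map_prod f g p, map_prod f g q) \<in> parcs (direct_product G H) \<longleftrightarrow>
    (p, q) \<in> parcs (direct_product G H)"
  using assms by (auto simp: parcs_direct_product graph_auts_arc)

text \<open>Stability supplies some abstract isomorphism, which need not be the natural embedding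
  \<open>?T\<close>. It is used only to equate the two group orders; an injection between finite
  sets of equal size is then onto.\<close>

lemma stable_pair_product_auts_only:
  assumes "finite (pverts G)" "finite (pverts H)" "pverts G \<noteq> {}" "pverts H \<noteq> {}"
    and "stable_pair G H"
  shows "product_auts_only G H"
  unfolding product_auts_only_def
proof (intro allI impI, elim conjE)
  let ?V = "pverts G \<times> pverts H" and ?P = "direct_product G H"
  let ?T = "\<lambda>(f, g). restrict (map_prod f g) ?V"
  fix \<theta> assume "bij_betw \<theta> ?V ?V"
    and "\<forall>p \<in> ?V. \<forall>q \<in> ?V. (\<theta> p, \<theta> q) \<in> parcs ?P \<longleftrightarrow> (p, q) \<in> parcs ?P"
  then have \<theta>: "restrict \<theta> ?V \<in> graph_auts ?P"
    using restrict_in_graph_auts[of \<theta> ?P] unfolding pverts_direct_product by blast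
  have card: "card (graph_auts ?P) = card (graph_auts G \<times> graph_auts H)"
    using iso_same_card assms(5) unfolding stable_pair_def
    by (fastforce simp: graph_Aut_def DirProd_def)
  have sub: "?T ` (graph_auts G \<times> graph_auts H) \<subseteq> graph_auts ?P"
  proof safe
    fix f g assume fg: "f \<in> graph_auts G" "g \<in> graph_auts H"
    show "restrict (map_prod f g) ?V \<in> graph_auts ?P"
      using restrict_in_graph_auts[of "map_prod f g" ?P] map_prod_graph_auts_arc[OF fg]
        bij_betw_map_prod_Times[OF fg[THEN graph_auts_bij]]
      by (simp add: pverts_direct_product)
  qed
  have inj: "inj_on ?T (graph_auts G \<times> graph_auts H)"
  proof (rule inj_onI)
    fix a b assume a: "a \<in> graph_auts G \<times> graph_auts H" and b: "b \<in> graph_auts G \<times> graph_auts H"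
      and eq: "?T a = ?T b"
    have *: "fst a u = fst b u \<and> snd a x = snd b x" if "u \<in> pverts G" "x \<in> pverts H" for u x
      using fun_cong[OF eq, of "(u, x)"] that by (simp add: split_beta)
    have "fst a = fst b"
      \<comment> \<open>A value of \<open>fst a\<close> shows up in the product only next to a
        vertex of \<open>H\<close>; this is where \<open>pverts H \<noteq> {}\<close>
        enters.\<close>
      using a b * assms(4) by (intro extensionalityI[of _ "pverts G"] graph_auts_extensional) auto
    moreover have "snd a = snd b"
      using a b * assms(3) by (intro extensionalityI[of _ "pverts H"] graph_auts_extensional) auto
    ultimately show "a = b" by (simp add: prod_eq_iff)
  qed
  have "?T ` (graph_auts G \<times> graph_auts H) = graph_auts ?P"
    using assms(1,2)
    by (intro card_subset_eq finite_graph_auts sub)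
      (simp_all add: card_image[OF inj] card pverts_direct_product)
  then obtain f g where fg: "f \<in> graph_auts G" "g \<in> graph_auts H"
      "restrict \<theta> ?V = restrict (map_prod f g) ?V"
    using \<theta> by fastforce
  have "\<theta> (u, x) = (f u, g x)" if "u \<in> pverts G" "x \<in> pverts H" for u x
    using fun_cong[OF fg(3), of "(u, x)"] that by simp
  then show "\<exists>f \<in> graph_auts G. \<exists>g \<in> graph_auts H.
      \<forall>u \<in> pverts G. \<forall>x \<in> pverts H. \<theta> (u, x) = (f u, g x)"
    using fg by blast
qed

text \<open>Conjugation by \<open>prod.swap\<close> carries automorphisms of one product to those of
  the other. It lets results about the first factor be reused for the second.\<close>

lemma product_auts_only_swap:
  assumes "product_auts_only G H"
  shows "product_auts_only H G"
  unfolding product_auts_only_def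
proof (intro allI impI, elim conjE)
  let ?V = "pverts G \<times> pverts H" and ?W = "pverts H \<times> pverts G"
  fix \<theta> assume bij: "bij_betw \<theta> ?W ?W"
    and arc: "\<forall>p \<in> ?W. \<forall>q \<in> ?W.
      (\<theta> p, \<theta> q) \<in> parcs (direct_product H G) \<longleftrightarrow> (p, q) \<in> parcs (direct_product H G)"
  have "bij_betw prod.swap ?V ?W" "bij_betw prod.swap ?W ?V"
    by (auto simp: bij_betw_def product_swap)
  then have bij': "bij_betw (prod.swap \<circ> (\<theta> \<circ> prod.swap)) ?V ?V"
    using bij by (blast intro: bij_betw_trans)
  have arc': "((prod.swap \<circ> (\<theta> \<circ> prod.swap)) p, (prod.swap \<circ> (\<theta> \<circ> prod.swap)) q)
      \<in> parcs (direct_product G H) \<longleftrightarrow> (p, q) \<in> parcs (direct_product G H)"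
    if "p \<in> ?V" "q \<in> ?V" for p q
  proof -
    have "(\<theta> (prod.swap p), \<theta> (prod.swap q)) \<in> parcs (direct_product H G) \<longleftrightarrow>
        (prod.swap p, prod.swap q) \<in> parcs (direct_product H G)"
      using arc that by auto
    then show ?thesis by (simp add: parcs_direct_product conj_commute)
  qed
  obtain g f where "g \<in> graph_auts G" "f \<in> graph_auts H"
    and "\<And>u x. u \<in> pverts G \<Longrightarrow> x \<in> pverts H \<Longrightarrow>
      (prod.swap \<circ> (\<theta> \<circ> prod.swap)) (u, x) = (g u, f x)"
    using product_auts_onlyE[OF assms bij' arc'] by blast
  moreover from this(3) have "\<theta> (x, u) = (f x, g u)" if "x \<in> pverts H" "u \<in> pverts G" for x u
    using that by (metis comp_apply swap_simp swap_swap)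
  ultimately show "\<exists>f \<in> graph_auts H. \<exists>g \<in> graph_auts G.
      \<forall>x \<in> pverts H. \<forall>u \<in> pverts G. \<theta> (x, u) = (f x, g u)"
    by blast
qed

section \<open>Twins and R-thinness\<close>

text \<open>Transposing twins in the first argument changes nothing because their neighbourhoods
  agree; symmetry brings the second argument to the front, where the same applies.\<close>

lemma twin_arc:
  assumes sym: "sym (parcs G)" and N: "neighbourhood G u = neighbourhood G v"
  shows "(transpose u v p, transpose u v q) \<in> parcs G \<longleftrightarrow> (p, q) \<in> parcs G"
proof -
  have 1: "(transpose u v p, q) \<in> parcs G \<longleftrightarrow> (p, q) \<in> parcs G" for p q
    using N by (auto simp: transpose_def neighbourhood_def set_eq_iff)
  have "(transpose u v p, transpose u v q) \<in> parcs G \<longleftrightarrow> (transpose u v q, p) \<in> parcs G"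
    using 1 sym by (meson symD)
  then show ?thesis
    using 1 sym by (meson symD)
qed

text \<open>Twins \<open>u\<close>, \<open>v\<close> of \<open>G\<close> give twins
  \<open>(u, x)\<close>, \<open>(v, x)\<close> of the product. Transposing these acts on the fibre
  over \<open>x\<close> but not on the one over \<open>y\<close>, which no pair of automorphisms can
  do.\<close>

lemma R_thin_if_nontrivial_cofactor:
  assumes po: "product_auts_only G H"
    and sym: "sym (parcs G)" "sym (parcs H)"
    and x: "x \<in> pverts H" and y: "y \<in> pverts H" "x \<noteq> y"
  shows "R_thin G"
proof
  assume "R_thick G"
  then obtain u v where uv: "u \<in> pverts G" "v \<in> pverts G" "u \<noteq> v"
      "neighbourhood G u = neighbourhood G v"
    by (auto simp: R_thick_def)
  let ?P = "direct_product G H"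
  let ?t = "transpose (u, x) (v, x)"
  have "sym (parcs ?P)"
    using sym by (auto intro!: symI simp: parcs_direct_product dest: symD)
  moreover have "neighbourhood ?P (u, x) = neighbourhood ?P (v, x)"
    using uv(4) by (auto simp: neighbourhood_def parcs_direct_product set_eq_iff)
  ultimately have arc: "(?t p, ?t q) \<in> parcs ?P \<longleftrightarrow> (p, q) \<in> parcs ?P" for p q
    by (rule twin_arc)
  have "bij_betw ?t (pverts G \<times> pverts H) (pverts G \<times> pverts H)"
    using uv x by (simp add: bij_betw_transpose_iff)
  from product_auts_onlyE[OF po this arc]
  obtain f g where "\<And>u x. u \<in> pverts G \<Longrightarrow> x \<in> pverts H \<Longrightarrow> ?t (u, x) = (f u, g x)"
    by metis
  \<comment> \<open>The image of \<open>(u, x)\<close> gives \<open>f u = v\<close>, while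
    \<open>(u, y)\<close> is fixed and gives \<open>f u = u\<close>.\<close>
  from this[OF uv(1) x] this[OF uv(1) y(1)] show False
    using y uv by (simp add: transpose_def)
qed

text \<open>The product has no arcs, so every permutation of \<open>pverts G\<close> induces an
  automorphism of it and hence must preserve the arcs of \<open>G\<close>. Moving the arc
  \<open>(a, b)\<close> onto twins \<open>(u, v)\<close> makes the twins adjacent, and then
  \<open>v\<close> has a loop.\<close>

lemma R_thin_if_singleton_cofactor:
  assumes po: "product_auts_only G H"
    and loopfree: "\<And>u. (u, u) \<notin> parcs G"
    and H: "pverts H = {x}" "parcs H = {}"
    and ab: "(a, b) \<in> parcs G" "a \<in> pverts G" "b \<in> pverts G"
  shows "R_thin G"
proof
  assume "R_thick G"
  then obtain u v where uv: "u \<in> pverts G" "v \<in> pverts G" "u \<noteq> v"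
      "neighbourhood G u = neighbourhood G v"
    by (auto simp: R_thick_def)
  have "a \<noteq> b" using ab loopfree by auto
  \<comment> \<open>First \<open>a\<close> is sent to \<open>u\<close>, which moves \<open>b\<close>
    to \<open>?c\<close>; then \<open>?c\<close> is sent to \<open>v\<close>. The second
    transposition leaves \<open>u\<close> alone since \<open>u\<close> differs from both
    \<open>?c\<close> and \<open>v\<close>.\<close>
  let ?c = "transpose a u b"
  let ?\<pi> = "transpose ?c v \<circ> transpose a u"
  have c: "?c \<in> pverts G" "?c \<noteq> u"
    using ab uv \<open>a \<noteq> b\<close> by (auto simp: transpose_def)
  have "bij_betw ?\<pi> (pverts G) (pverts G)"
    using ab uv c by (intro bij_betw_trans[of _ _ "pverts G"]) (simp_all add: bij_betw_transpose_iff)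
  then have "bij_betw (map_prod ?\<pi> (\<lambda>x. x)) (pverts G \<times> pverts H) (pverts G \<times> pverts H)"
    by (rule bij_betw_map_prod_Times) (simp add: bij_betw_def)
  then obtain f g where f: "f \<in> graph_auts G"
    and eq: "\<And>u x. u \<in> pverts G \<Longrightarrow> x \<in> pverts H \<Longrightarrow> map_prod ?\<pi> (\<lambda>x. x) (u, x) = (f u, g x)"
    by (rule product_auts_onlyE[OF po]) (simp_all add: parcs_direct_product H)
  have "f a = u" "f b = v"
    using eq[of a x] eq[of b x] ab H c uv(3) by auto
  then have "(u, v) \<in> parcs G"
    using graph_auts_arc[OF f ab(2,3)] ab(1) by simp
  then have "(v, v) \<in> parcs G"
    using uv(4) by (auto simp: neighbourhood_def)
  then show False using loopfree by simp
qed

lemma pair_graph_sym: "pair_graph G \<Longrightarrow> sym (parcs G)"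
  using pair_sym_digraph.pair_sym_arcs[of G]
  by (simp add: symmetric_def pair_graph_def pair_pseudo_graph_def)

lemma pair_graph_loopfree: "pair_graph G \<Longrightarrow> (u, u) \<notin> parcs G"
  using pair_loopfree_digraph.pair_no_loops[of G "(u, u)"]
  by (auto simp: pair_graph_def pair_digraph_def)

text \<open>Assumption \<open>nd\<close> rules out the situation of
  \<open>stable_pair_degenerate\<close> with the factors exchanged, where
  \<open>R_thick_edgeless\<close> shows that \<open>G\<close> is R-thick.\<close>

lemma R_thin_if_product_auts_only:
  assumes po: "product_auts_only G H" and G: "pair_graph G" and H: "pair_graph H"
    and ne: "pverts H \<noteq> {}"
    and nd: "\<not> (card (pverts H) = 1 \<and> parcs G = {} \<and> card (pverts G) \<ge> 2)"
  shows "R_thin G"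
proof (cases "\<exists>x\<in>pverts H. \<exists>y\<in>pverts H. x \<noteq> y")
  case True
  then show ?thesis
    using R_thin_if_nontrivial_cofactor[OF po pair_graph_sym[OF G] pair_graph_sym[OF H]] by blast
next
  case False
  interpret G: pair_graph G by fact
  interpret H: pair_graph H by fact
  obtain x where x: "pverts H = {x}" using False ne by blast
  have H0: "parcs H = {}"
    using pair_graph_loopfree[OF H, of x] H.wellformed' x by fastforce
  show ?thesis
  proof (cases "parcs G = {}")
    case True
    then have "card (pverts G) \<le> 1" using nd x by simp
    then show ?thesis
      using G.pair_finite_verts by (auto simp: R_thick_def card_le_Suc0_iff_eq)
  next
    case False
    then obtain a b where "(a, b) \<in> parcs G" by auto
    then show ?thesis
      using R_thin_if_singleton_cofactor[OF po pair_graph_loopfree[OF G] x H0]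
      by (blast dest: G.wellformed')
  qed
qed

section \<open>Common factors and coprimality\<close>

text \<open>A library isomorphism has separate vertex and arc maps. Between \<open>with_proj\<close>
  digraphs head and tail are the projections on both sides, so the arc map is determined by the
  vertex map.\<close>

lemma digraph_iso_with_projE:
  assumes iso: "digraph_iso (with_proj G) (with_proj K)"
  obtains f where "bij_betw f (pverts G) (pverts K)"
    "\<And>u v. u \<in> pverts G \<Longrightarrow> v \<in> pverts G \<Longrightarrow> (f u, f v) \<in> parcs K \<longleftrightarrow> (u, v) \<in> parcs G"
proof -
  obtain h where h: "pre_digraph.digraph_isomorphism (with_proj G) h"
    and K: "with_proj K = app_iso h (with_proj G)"
    using iso by (auto simp: digraph_iso_def)
  let ?f = "iso_verts h"
  have V: "pverts K = ?f ` pverts G" and A: "parcs K = iso_arcs h ` parcs G"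
    and T: "iso_tail h = fst" and D: "iso_head h = snd"
    using K by (auto simp: app_iso_def with_proj_def)
  have inj: "inj_on ?f (pverts G)" and wf: "pair_wf_digraph G"
    and h_arc: "\<And>a. a \<in> parcs G \<Longrightarrow> iso_arcs h a = (?f (fst a), ?f (snd a))"
    using h T D by (auto simp: pre_digraph.digraph_isomorphism_def wf_digraph_wp_iff prod_eq_iff)
  show ?thesis
  proof (rule that[of ?f])
    show "bij_betw ?f (pverts G) (pverts K)" using V inj by (simp add: bij_betw_def)
    fix u v assume uv: "u \<in> pverts G" "v \<in> pverts G"
    show "(?f u, ?f v) \<in> parcs K \<longleftrightarrow> (u, v) \<in> parcs G"
    proof
      assume "(?f u, ?f v) \<in> parcs K"
      then obtain a b where ab: "(a, b) \<in> parcs G" "(?f u, ?f v) = (?f a, ?f b)"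
        unfolding A using h_arc by fastforce
      then show "(u, v) \<in> parcs G"
        using uv inj pair_wf_digraph.wellformed'[OF wf ab(1)] by (auto dest: inj_onD)
    next
      assume "(u, v) \<in> parcs G"
      then show "(?f u, ?f v) \<in> parcs K" unfolding A using h_arc by force
    qed
  qed
qed

text \<open>With \<open>G\<close> identified with \<open>G1 \<times> D\<close> and \<open>H\<close>
  with \<open>H1 \<times> D\<close>, exchanging the two \<open>D\<close>-coordinates is an
  automorphism of the product. Its \<open>G\<close>-component depends on the vertex of
  \<open>H\<close>, so it is not a pair.\<close>

lemma coprime_graphs_if_product_auts_only:
  assumes po: "product_auts_only G H" and ne: "pverts G \<noteq> {}" "pverts H \<noteq> {}"
  shows "coprime_graphs G H"
  unfolding coprime_graphs_def
proof (rule notI, elim exE conjE)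
  fix D G1 H1 :: "nat pair_pre_digraph"
  assume card: "card (pverts D) > 1"
    and "digraph_iso (with_proj G) (with_proj (direct_product G1 D))"
    and "digraph_iso (with_proj H) (with_proj (direct_product H1 D))"
  then obtain f g where f: "bij_betw f (pverts G) (pverts G1 \<times> pverts D)"
    and f_arc: "\<And>u v. u \<in> pverts G \<Longrightarrow> v \<in> pverts G \<Longrightarrow>
      (u, v) \<in> parcs G \<longleftrightarrow> (f u, f v) \<in> parcs (direct_product G1 D)"
    and g: "bij_betw g (pverts H) (pverts H1 \<times> pverts D)"
    and g_arc: "\<And>u v. u \<in> pverts H \<Longrightarrow> v \<in> pverts H \<Longrightarrow>
      (u, v) \<in> parcs H \<longleftrightarrow> (g u, g v) \<in> parcs (direct_product H1 D)"
    by (auto elim!: digraph_iso_with_projE simp: pverts_direct_product)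
  let ?V = "pverts G \<times> pverts H"
  let ?F = "inv_into (pverts G) f" and ?G = "inv_into (pverts H) g"
  let ?W = "(pverts G1 \<times> pverts D) \<times> (pverts H1 \<times> pverts D)"
  let ?s = "\<lambda>((a, d), (b, e)). ((a, e), (b, d))"
  \<comment> \<open>This is the exchange \<open>?s\<close> transported back along \<open>f\<close>
    and \<open>g\<close>.\<close>
  let ?\<theta> = "map_prod ?F ?G \<circ> (?s \<circ> map_prod f g)"
  have "bij_betw ?s ?W ?W"
    by (rule bij_betw_byWitness[where f' = ?s]) auto
  then have bij: "bij_betw ?\<theta> ?V ?V"
    by (intro bij_betw_trans[of _ _ ?W] bij_betw_map_prod_Times f g bij_betw_inv_into)
  have fF: "f (?F p) = p" "?F p \<in> pverts G" if "p \<in> pverts G1 \<times> pverts D" for p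
    using f that by (auto simp: bij_betw_def f_inv_into_f inv_into_into)
  have gG: "g (?G p) = p" "?G p \<in> pverts H" if "p \<in> pverts H1 \<times> pverts D" for p
    using g that by (auto simp: bij_betw_def f_inv_into_f inv_into_into)
  have f_in: "f u \<in> pverts G1 \<times> pverts D" if "u \<in> pverts G" for u
    using f that by (auto simp: bij_betw_def)
  have g_in: "g u \<in> pverts H1 \<times> pverts D" if "u \<in> pverts H" for u
    using g that by (auto simp: bij_betw_def)
  have \<theta>: "?\<theta> (u, x) = (?F (fst (f u), snd (g x)), ?G (fst (g x), snd (f u)))" for u x
    by (simp add: split_beta)
  have arc: "(?\<theta> p, ?\<theta> q) \<in> parcs (direct_product G H) \<longleftrightarrow> (p, q) \<in> parcs (direct_product G H)"
    if pq: "p \<in> ?V" "q \<in> ?V" for p q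
  proof -
    obtain u x v y where eq: "p = (u, x)" "q = (v, y)" by (metis prod.collapse)
    then have "u \<in> pverts G" "v \<in> pverts G" "x \<in> pverts H" "y \<in> pverts H" using pq by auto
    moreover from this f_in g_in
    have "(fst (f u), snd (g x)) \<in> pverts G1 \<times> pverts D" "(fst (g x), snd (f u)) \<in> pverts H1 \<times> pverts D"
      "(fst (f v), snd (g y)) \<in> pverts G1 \<times> pverts D" "(fst (g y), snd (f v)) \<in> pverts H1 \<times> pverts D"
      by (auto simp: mem_Times_iff)
    \<comment> \<open>Both sides unfold to the same four adjacencies, one in \<open>G1\<close>, one
      in \<open>H1\<close> and two in \<open>D\<close>, merely reordered.\<close>
    ultimately show ?thesis
      unfolding eq \<theta> by (auto simp: parcs_direct_product f_arc g_arc fF gG)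
  qed
  obtain k l where kl: "\<And>u x. u \<in> pverts G \<Longrightarrow> x \<in> pverts H \<Longrightarrow> ?\<theta> (u, x) = (k u, l x)"
    using product_auts_onlyE[OF po bij arc] by metis
  obtain u x where u: "u \<in> pverts G" and x: "x \<in> pverts H" using ne by blast
  have "\<not> pverts D \<subseteq> {snd (g x)}"
    using card card_mono[of "{snd (g x)}" "pverts D"] by auto
  then obtain d where d: "d \<in> pverts D" "d \<noteq> snd (g x)" by blast
  \<comment> \<open>The vertex \<open>?y\<close> differs from \<open>x\<close> only in its
    \<open>D\<close>-coordinate. The first components of the images of \<open>(u, x)\<close> and
    \<open>(u, ?y)\<close> both equal \<open>k u\<close>, yet they carry these different
    coordinates.\<close>
  let ?y = "?G (fst (g x), d)"
  have y: "(fst (g x), d) \<in> pverts H1 \<times> pverts D" using d g_in[OF x] by (auto simp: mem_Times_iff)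
  have "?F (fst (f u), snd (g x)) = ?F (fst (f u), d)"
    using kl[OF u x] kl[OF u gG(2)[OF y]] unfolding \<theta> gG(1)[OF y] by simp
  moreover have "(fst (f u), snd (g x)) \<in> pverts G1 \<times> pverts D" "(fst (f u), d) \<in> pverts G1 \<times> pverts D"
    using d f_in[OF u] g_in[OF x] by (auto simp: mem_Times_iff)
  ultimately have "(fst (f u), snd (g x)) = (fst (f u), d)" using fF(1) by metis
  then show False using d by simp
qed

section \<open>Unions of components and connectedness\<close>

text \<open>Within the vertex set of a well-formed graph these are the unions of connected
  components. Points that are not vertices are unconstrained, so sets such as
  \<open>C \<times> UNIV\<close> qualify.\<close>

definition arc_closed :: "'a pair_pre_digraph \<Rightarrow> 'a set \<Rightarrow> bool" where
  "arc_closed G C \<longleftrightarrow> (\<forall>(u, v) \<in> parcs G. u \<in> C \<longleftrightarrow> v \<in> C)"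

lemma arc_closedD: "arc_closed G C \<Longrightarrow> (u, v) \<in> parcs G \<Longrightarrow> u \<in> C \<longleftrightarrow> v \<in> C"
  by (auto simp: arc_closed_def)

lemma connected_arc_closedD:
  assumes con: "connected (with_proj G)" and C: "arc_closed G C"
    and uv: "u \<in> pverts G" "v \<in> pverts G"
  shows "u \<in> C \<longleftrightarrow> v \<in> C"
proof -
  have "(u, v) \<in> rtrancl_on (pverts G) ((parcs G)\<^sup>s)"
    using con uv by (simp add: connected_conv)
  then show ?thesis
    by (induction rule: rtrancl_on_induct) (auto simp: symcl_def dest: arc_closedD[OF C])
qed

text \<open>The witness is the component of \<open>u\<close>: everything reachable from it along
  symmetrised arcs.\<close>

lemma disconnectedE:
  assumes wf: "pair_wf_digraph G" and ncon: "\<not> connected (with_proj G)" and ne: "pverts G \<noteq> {}"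
  obtains C u v where "arc_closed G C" "u \<in> pverts G" "u \<in> C" "v \<in> pverts G" "v \<notin> C"
proof -
  interpret pair_wf_digraph G by fact
  let ?R = "rtrancl_on (pverts G) ((parcs G)\<^sup>s)"
  obtain u v where uv: "u \<in> pverts G" "v \<in> pverts G" "(u, v) \<notin> ?R"
    using ncon ne by (auto simp: connected_conv)
  have "arc_closed G {w. (u, w) \<in> ?R}"
    unfolding arc_closed_def
  proof (clarsimp, intro iffI)
    fix a b assume ab: "(a, b) \<in> parcs G"
    show "(u, b) \<in> ?R" if "(u, a) \<in> ?R"
      using that ab wellformed'[OF ab] by - (rule rtrancl_on_into_rtrancl_on, auto simp: symcl_def)
    show "(u, a) \<in> ?R" if "(u, b) \<in> ?R"
      using that ab wellformed'[OF ab] by - (rule rtrancl_on_into_rtrancl_on, auto simp: symcl_def)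
  qed
  then show ?thesis using uv by (intro that[of "{w. (u, w) \<in> ?R}" u v]) auto
qed

text \<open>Applying \<open>(f0, g0)\<close> on \<open>S\<close> and the identity elsewhere is an
  automorphism, because no arc crosses the border of \<open>S\<close> and the pair preserves
  \<open>S\<close>. Being itself a pair, it links values inside \<open>S\<close> to values outside,
  which later yields contradictions.\<close>

lemma piecewise_product_aut:
  assumes po: "product_auts_only G H"
    and f0: "f0 \<in> graph_auts G" and g0: "g0 \<in> graph_auts H"
    and S: "arc_closed (direct_product G H) S"
    and inv: "\<And>u x. u \<in> pverts G \<Longrightarrow> x \<in> pverts H \<Longrightarrow> (f0 u, g0 x) \<in> S \<longleftrightarrow> (u, x) \<in> S"
  obtains f g where "\<And>u x. u \<in> pverts G \<Longrightarrow> x \<in> pverts H \<Longrightarrow>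
    (f u, g x) = (if (u, x) \<in> S then (f0 u, g0 x) else (u, x))"
proof -
  let ?V = "pverts G \<times> pverts H"
  let ?\<theta> = "\<lambda>p. if p \<in> S then map_prod f0 g0 p else p"
  have b: "bij_betw (map_prod f0 g0) ?V ?V"
    by (intro bij_betw_map_prod_Times graph_auts_bij f0 g0)
  have invp: "map_prod f0 g0 p \<in> S \<longleftrightarrow> p \<in> S" if "p \<in> ?V" for p
    using inv that by auto
  have "inj_on ?\<theta> ?V"
    using b invp unfolding bij_betw_def inj_on_def by (smt (verit))
  moreover have "?\<theta> ` ?V = ?V"
  proof
    show "?\<theta> ` ?V \<subseteq> ?V" using b by (auto simp: bij_betw_def graph_auts_in f0 g0)
    show "?V \<subseteq> ?\<theta> ` ?V"
    proof
      fix p assume p: "p \<in> ?V"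
      then obtain q where q: "q \<in> ?V" "p = map_prod f0 g0 q"
        using bij_betw_imp_surj_on[OF b] by (metis (no_types) imageE)
      show "p \<in> ?\<theta> ` ?V"
        using p q invp[OF q(1)] by (cases "p \<in> S") (auto intro: rev_image_eqI)
    qed
  qed
  ultimately have bij: "bij_betw ?\<theta> ?V ?V" by (simp add: bij_betw_def)
  have arc: "(?\<theta> p, ?\<theta> q) \<in> parcs (direct_product G H) \<longleftrightarrow> (p, q) \<in> parcs (direct_product G H)"
    if "p \<in> ?V" "q \<in> ?V" for p q
    \<comment> \<open>If \<open>p\<close> and \<open>q\<close> lie on different sides of
      \<open>S\<close>, so do their images, and neither pair is an arc.\<close>
    using map_prod_graph_auts_arc[OF f0 g0 that] invp[OF that(1)] invp[OF that(2)]
      arc_closedD[OF S, of p q] arc_closedD[OF S, of "?\<theta> p" "?\<theta> q"] by auto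
  from product_auts_onlyE[OF po bij arc] obtain f g where
    "\<And>u x. u \<in> pverts G \<Longrightarrow> x \<in> pverts H \<Longrightarrow> ?\<theta> (u, x) = (f u, g x)" by metis
  then show ?thesis by (intro that[of f g]) (metis map_prod_simp)
qed

text \<open>For a proper union of components \<open>C\<close> of \<open>G\<close>, let
  \<open>g0\<close> act only over \<open>C\<close>. The second component of the image of a vertex
  over \<open>x\<close> would then be \<open>g0 x\<close> above \<open>u\<close> and
  \<open>x\<close> above \<open>v\<close>.\<close>

lemma connected_if_product_auts_only:
  assumes po: "product_auts_only G H" and wf: "pair_wf_digraph G" and ne: "pverts G \<noteq> {}"
    and nt: "\<not> trivial_group (graph_Aut H)"
  shows "connected (with_proj G)"
proof (rule ccontr)
  assume "\<not> connected (with_proj G)"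
  from disconnectedE[OF wf this ne] obtain C u v where C: "arc_closed G C"
    and uv: "u \<in> pverts G" "u \<in> C" "v \<in> pverts G" "v \<notin> C" .
  obtain g0 x where g0: "g0 \<in> graph_auts H" and x: "x \<in> pverts H" "g0 x \<noteq> x"
    using nontrivial_graph_AutE[OF nt] .
  have "arc_closed (direct_product G H) (C \<times> UNIV)"
    using C by (auto simp: arc_closed_def parcs_direct_product)
  then obtain f g where fg: "\<And>u x. u \<in> pverts G \<Longrightarrow> x \<in> pverts H \<Longrightarrow>
      (f u, g x) = (if (u, x) \<in> C \<times> UNIV then ((\<lambda>u\<in>pverts G. u) u, g0 x) else (u, x))"
    by (rule piecewise_product_aut[OF po id_in_graph_auts g0]) auto
  show False
    using fg[OF uv(1) x(1)] fg[OF uv(3) x(1)] uv x by simp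
qed

section \<open>Bipartite factors\<close>

text \<open>The complement of \<open>U\<close> takes the place of the second class, so membership in
  \<open>U\<close> is a parity that flips along every arc.\<close>

lemma bipartiteE:
  assumes "bipartite G"
  obtains U where "\<And>u v. (u, v) \<in> parcs G \<Longrightarrow> u \<in> U \<longleftrightarrow> v \<notin> U"
proof -
  obtain U W where "U \<inter> W = {}" "\<forall>(u, v) \<in> parcs G. u \<in> U \<and> v \<in> W \<or> u \<in> W \<and> v \<in> U"
    using assms unfolding bipartite_def by (elim exE conjE) (rule that)
  then show ?thesis by (intro that[of U]) blast
qed

text \<open>Two distinct vertices of a connected graph force an arc, since otherwise
  \<open>{u}\<close> would be closed; the ends of that arc have opposite parities.\<close>

lemma bipartite_part_proper:
  assumes con: "connected (with_proj G)"
    and U: "\<And>u v. (u, v) \<in> parcs G \<Longrightarrow> u \<in> U \<longleftrightarrow> v \<notin> U"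
    and wf: "pair_wf_digraph G"
    and uv: "u \<in> pverts G" "v \<in> pverts G" "u \<noteq> v"
  obtains a b where "a \<in> pverts G" "a \<in> U" "b \<in> pverts G" "b \<notin> U"
proof -
  have "parcs G \<noteq> {}"
    using connected_arc_closedD[OF con _ uv(1,2), of "{u}"] uv(3) by (auto simp: arc_closed_def)
  then obtain a b where "(a, b) \<in> parcs G" by auto
  then show ?thesis
    using U[of a b] pair_wf_digraph.wellformed'[OF wf, of a b] that by (cases "a \<in> U") auto
qed

text \<open>Along an arc the parities of \<open>u\<close> and of \<open>f u\<close> both flip, so
  the set where \<open>f\<close> preserves parity is closed, hence contains all vertices or
  none.\<close>

lemma bipartite_aut_cases:
  assumes con: "connected (with_proj G)" and wf: "pair_wf_digraph G"
    and U: "\<And>u v. (u, v) \<in> parcs G \<Longrightarrow> u \<in> U \<longleftrightarrow> v \<notin> U"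
    and f: "f \<in> graph_auts G"
  obtains "\<And>u. u \<in> pverts G \<Longrightarrow> f u \<in> U \<longleftrightarrow> u \<in> U" | "\<And>u. u \<in> pverts G \<Longrightarrow> f u \<in> U \<longleftrightarrow> u \<notin> U"
proof -
  let ?C = "{u. f u \<in> U \<longleftrightarrow> u \<in> U}"
  have closed: "arc_closed G ?C"
    unfolding arc_closed_def
  proof clarify
    fix u v assume uv: "(u, v) \<in> parcs G"
    then have "(f u, f v) \<in> parcs G"
      using graph_auts_arc[OF f] pair_wf_digraph.wellformed'[OF wf uv] by blast
    then show "u \<in> ?C \<longleftrightarrow> v \<in> ?C" using U[OF uv] U[of "f u" "f v"] by auto
  qed
  have *: "(f u \<in> U \<longleftrightarrow> u \<in> U) \<longleftrightarrow> (f v \<in> U \<longleftrightarrow> v \<in> U)" if "u \<in> pverts G" "v \<in> pverts G" for u v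
    using connected_arc_closedD[OF con closed that] by simp
  show ?thesis
  proof (cases "\<forall>u \<in> pverts G. f u \<in> U \<longleftrightarrow> u \<in> U")
    case True
    then show ?thesis by (intro that(1)) blast
  next
    case False
    then show ?thesis using * by (intro that(2)) blast
  qed
qed

text \<open>The product of two bipartite graphs splits into vertices of equal and of unequal
  parities. Some nontrivial pair of automorphisms preserves this splitting and can be applied on one
  side only.\<close>

lemma not_both_bipartite_if_product_auts_only:
  assumes po: "product_auts_only G H" and G: "pair_wf_digraph G" and H: "pair_wf_digraph H"
    and con: "connected (with_proj G)" "connected (with_proj H)"
    and nt: "\<not> trivial_group (graph_Aut G)" "\<not> trivial_group (graph_Aut H)"
  shows "\<not> bipartite G \<or> \<not> bipartite H"
proof (rule ccontr)
  assume "\<not> ?thesis"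
  then have "bipartite G" "bipartite H" by auto
  obtain U where U: "\<And>u v. (u, v) \<in> parcs G \<Longrightarrow> u \<in> U \<longleftrightarrow> v \<notin> U"
    using bipartiteE[OF \<open>bipartite G\<close>] by blast
  obtain X where X: "\<And>x y. (x, y) \<in> parcs H \<Longrightarrow> x \<in> X \<longleftrightarrow> y \<notin> X"
    using bipartiteE[OF \<open>bipartite H\<close>] by blast
  obtain f0 u where f0: "f0 \<in> graph_auts G" and u: "u \<in> pverts G" "f0 u \<noteq> u"
    using nontrivial_graph_AutE[OF nt(1)] .
  obtain g0 x where g0: "g0 \<in> graph_auts H" and x: "x \<in> pverts H" "g0 x \<noteq> x"
    using nontrivial_graph_AutE[OF nt(2)] .
  obtain u1 u2 where u12: "u1 \<in> pverts G" "u1 \<in> U" "u2 \<in> pverts G" "u2 \<notin> U"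
    by (rule bipartite_part_proper[OF con(1) U G u(1) graph_auts_in[OF f0 u(1)]]) (use u in auto)
  obtain x1 x2 where x12: "x1 \<in> pverts H" "x1 \<in> X" "x2 \<in> pverts H" "x2 \<notin> X"
    by (rule bipartite_part_proper[OF con(2) X H x(1) graph_auts_in[OF g0 x(1)]]) (use x in auto)
  let ?S = "{(u, x). u \<in> U \<longleftrightarrow> x \<in> X}"
  have S: "arc_closed (direct_product G H) ?S"
    unfolding arc_closed_def
  proof clarify
    fix u x v y assume "((u, x), (v, y)) \<in> parcs (direct_product G H)"
    then show "(u, x) \<in> ?S \<longleftrightarrow> (v, y) \<in> ?S"
      using U[of u v] X[of x y] by (auto simp: parcs_direct_product)
  qed
  \<comment> \<open>For fixed \<open>u\<close>, exactly one of \<open>(u, x1)\<close> and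
    \<open>(u, x2)\<close> lies in \<open>?S\<close>, so \<open>k u\<close> equals both
    \<open>f u\<close> and \<open>u\<close>; symmetrically for \<open>g\<close>.\<close>
  have trivial: "f u = u \<and> g x = x"
    if f: "f \<in> graph_auts G" and g: "g \<in> graph_auts H" and u: "u \<in> pverts G" and x: "x \<in> pverts H"
      and inv: "\<And>u x. u \<in> pverts G \<Longrightarrow> x \<in> pverts H \<Longrightarrow> (f u, g x) \<in> ?S \<longleftrightarrow> (u, x) \<in> ?S"
    for f g u x
  proof -
    obtain k l where kl: "\<And>u x. u \<in> pverts G \<Longrightarrow> x \<in> pverts H \<Longrightarrow>
        (k u, l x) = (if (u, x) \<in> ?S then (f u, g x) else (u, x))"
      using piecewise_product_aut[OF po f g S inv] by metis
    have "f u = u"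
      using kl[OF u x12(1)] kl[OF u x12(3)] x12 by (cases "u \<in> U") auto
    moreover have "g x = x"
      using kl[OF u12(1) x] kl[OF u12(3) x] u12 by (cases "x \<in> X") auto
    ultimately show ?thesis ..
  qed
  show False
  proof (rule bipartite_aut_cases[OF con(1) G U f0])
    assume "\<And>u. u \<in> pverts G \<Longrightarrow> f0 u \<in> U \<longleftrightarrow> u \<in> U"
    then have "f0 u = u"
      using trivial[OF f0 id_in_graph_auts u(1) x(1)] by simp
    then show False using u by simp
  next
    assume f0_swap: "\<And>u. u \<in> pverts G \<Longrightarrow> f0 u \<in> U \<longleftrightarrow> u \<notin> U"
    show False
    proof (rule bipartite_aut_cases[OF con(2) H X g0])
      assume "\<And>x. x \<in> pverts H \<Longrightarrow> g0 x \<in> X \<longleftrightarrow> x \<in> X"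
      then have "g0 x = x"
        using trivial[OF id_in_graph_auts g0 u(1) x(1)] by simp
      then show False using x by simp
    next
      \<comment> \<open>When both automorphisms flip parity, neither preserves \<open>?S\<close> on
        its own, but together they do.\<close>
      assume "\<And>x. x \<in> pverts H \<Longrightarrow> g0 x \<in> X \<longleftrightarrow> x \<notin> X"
      then have "f0 u = u"
        using trivial[OF f0 g0 u(1) x(1)] f0_swap by simp
      then show False using u by simp
    qed
  qed
qed

theorem theorem1p3:
  fixes G :: "'a pair_pre_digraph" and H :: "'b pair_pre_digraph"
  assumes "pair_graph G" and "pair_graph H"
    and "pverts G \<noteq> {}" and "pverts H \<noteq> {}"
    and "\<not> (card (pverts G) = 1 \<and> parcs H = {} \<and> card (pverts H) \<ge> 2)"
    and "\<not> (card (pverts H) = 1 \<and> parcs G = {} \<and> card (pverts G) \<ge> 2)"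
    and "stable_pair G H"
  shows "coprime_graphs G H \<and> R_thin G \<and> R_thin H \<and>
    (\<not> trivial_group (graph_Aut G) \<and> \<not> trivial_group (graph_Aut H) \<longrightarrow>
      connected (with_proj G) \<and> connected (with_proj H) \<and> (\<not> bipartite G \<or> \<not> bipartite H))"
proof -
  interpret G: pair_graph G by fact
  interpret H: pair_graph H by fact
  have po: "product_auts_only G H"
    by (rule stable_pair_product_auts_only[OF G.pair_finite_verts H.pair_finite_verts assms(3,4,7)])
  note po' = product_auts_only_swap[OF po]
  have "connected (with_proj G)" "connected (with_proj H)" "\<not> bipartite G \<or> \<not> bipartite H"
    if nt: "\<not> trivial_group (graph_Aut G)" "\<not> trivial_group (graph_Aut H)"
  proof -
    show con: "connected (with_proj G)" "connected (with_proj H)"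
      using connected_if_product_auts_only[OF po _ assms(3) nt(2)]
        connected_if_product_auts_only[OF po' _ assms(4) nt(1)] by blast+
    show "\<not> bipartite G \<or> \<not> bipartite H"
      by (rule not_both_bipartite_if_product_auts_only[OF po _ _ con nt]) blast+
  qed
  then show ?thesis
    using coprime_graphs_if_product_auts_only[OF po assms(3,4)]
      R_thin_if_product_auts_only[OF po assms(1,2,4,6)]
      R_thin_if_product_auts_only[OF po' assms(2,1,3,5)]
    by blast
qed

end
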